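(* Let $1\le p\le\infty$. If $A\in\mathbb{C}^{m\times n}$, then $$\operatorname{sr}_p(A^*A)\le \operatorname{sr}_p(A)\qquad\text{and}\qquad \operatorname{sr}_p(AA^* )\le \operatorname{sr}_p(A).$$
   Context: $A^*$ denotes the conjugate transpose. For $1\le p<\infty$ and $A\in\mathbb{C}^{m\times n}$ with singular values $\sigma_1(A)\ge\cdots\ge\sigma_{\min\{m,n\}}(A)\ge 0$, the Schatten $p$-norm is $\|A\|_{(p)} = \left(\sum_{j}\sigma_j(A)^p\right)^{1/p}$, and $\|A\|_2=\sigma_1(A)$ is the operator two-norm. For $1\le p<\infty$ the $p$-stable rank of a non-zero matrix $A$ is $\operatorname{sr}_p(A) = \|A\|_{(p)}^p/\|A\|_2^p$; for $p=\infty$ the convention is $\operatorname{sr}_\infty(A)=1$ for non-zero $A$. For the zero matrix, $\operatorname{sr}_p(0)=0$ for all $p$. *)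

theory Defs
  imports
    "HOL-Library.Extended_Real"
    "Jordan_Normal_Form.Schur_Decomposition"
begin

lemma mat_adjoint_carrier:
  assumes "A \<in> carrier_mat m n"
  shows "mat_adjoint A \<in> carrier_mat n m"
  using assms by (auto simp: mat_adjoint_def)

lemma mat_adjoint_index:
  fixes A :: "complex mat"
  assumes "A \<in> carrier_mat m n" "i < n" "j < m"
  shows "mat_adjoint A $$ (i, j) = cnj (A $$ (j, i))"
  using assms by (auto simp: mat_adjoint_def mat_of_rows_index)

text \<open>
  The singular values of an \<open>m \<times> n\<close> matrix, in decreasing order and with multiplicity: the
  \<open>min m n\<close> largest square roots of eigenvalues of the Gram matrix \<open>A\<^sup>* A\<close>. That matrix is
  positive semidefinite, so taking \<open>Re\<close> loses nothing, and it has rank at most \<open>min m n\<close>, so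
  only zeros are dropped.
\<close>

definition singular_values :: "complex mat \<Rightarrow> real list" where
  "singular_values A =
     take (min (dim_row A) (dim_col A))
       (rev (sorted_list_of_multiset
          (image_mset (\<lambda>z. sqrt (Re z)) (proots (char_poly (mat_adjoint A * A))))))"

lemma length_singular_values:
  assumes A: "A \<in> carrier_mat m n"
  shows "length (singular_values A) = min m n"
proof -
  have "mat_adjoint A * A \<in> carrier_mat n n"
    using mat_adjoint_carrier[OF A] A by auto
  then have "degree (char_poly (mat_adjoint A * A)) = n"
    using degree_monic_char_poly by blast
  moreover have "length (sorted_list_of_multiset M) = size M" for M :: "real multiset"
    by (metis mset_sorted_list_of_multiset size_mset)
  ultimately show ?thesis
    using A by (simp add: singular_values_def size_proots_complex)
qed

lemma singular_values_decreasing: "sorted_wrt (\<ge>) (singular_values A)"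
  unfolding singular_values_def
  by (intro sorted_wrt_take) (simp add: sorted_wrt_rev)

definition schatten_norm :: "real \<Rightarrow> complex mat \<Rightarrow> real" where
  "schatten_norm p A = (\<Sum>\<sigma>\<leftarrow>singular_values A. \<sigma> powr p) powr (1 / p)"

text \<open>The operator two-norm is the largest singular value; it is meaningful for non-empty matrices.\<close>

definition two_norm :: "complex mat \<Rightarrow> real" where
  "two_norm A = singular_values A ! 0"

text \<open>
  The parameter is meaningful for \<open>1 \<le> p \<le> \<infinity>\<close>. The zero matrix is tested first, so it has stable
  rank \<open>0\<close> also for \<open>p = \<infinity>\<close>; every matrix with no rows or no columns counts as zero.
\<close>

definition stable_rank :: "ereal \<Rightarrow> complex mat \<Rightarrow> real" where
  "stable_rank p A =
     (if A = 0\<^sub>m (dim_row A) (dim_col A) then 0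
      else if p = \<infinity> then 1
      else schatten_norm (real_of_ereal p) A powr real_of_ereal p
             / two_norm A powr real_of_ereal p)"

end

theory Submission
  imports Defs
begin

text \<open>
  Passing from \<open>A\<close> to \<open>A\<^sup>* A\<close> or \<open>A A\<^sup>*\<close> squares each positive singular value, with multiplicity.
  The stable rank of a non-zero matrix is the sum of \<open>(\<sigma> / \<sigma>\<^sub>1)\<^sup>p\<close> over the positive singular values
  \<open>\<sigma>\<close>, and squaring a ratio in \<open>[0, 1]\<close> decreases it.
\<close>

section \<open>Algebra of the conjugate transpose\<close>

lemma mat_adjoint_mat_adjoint:
  fixes A :: "complex mat"
  shows "mat_adjoint (mat_adjoint A) = A"
proof -
  have A: "A \<in> carrier_mat (dim_row A) (dim_col A)"
    by simp
  note A' = mat_adjoint_carrier[OF A]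
  show ?thesis
    using A A' mat_adjoint_carrier[OF A']
    by (intro eq_matI) (simp_all add: mat_adjoint_index[OF A'] mat_adjoint_index[OF A])
qed

lemma mat_adjoint_mult:
  fixes A B :: "complex mat"
  assumes A: "A \<in> carrier_mat m n" and B: "B \<in> carrier_mat n k"
  shows "mat_adjoint (A * B) = mat_adjoint B * mat_adjoint A"
proof -
  have AB: "A * B \<in> carrier_mat m k"
    using A B by simp
  note A' = mat_adjoint_carrier[OF A]
  note B' = mat_adjoint_carrier[OF B]
  note AB' = mat_adjoint_carrier[OF AB]
  show ?thesis
  proof (rule eq_matI)
    fix i j
    assume "i < dim_row (mat_adjoint B * mat_adjoint A)" "j < dim_col (mat_adjoint B * mat_adjoint A)"
    then have i: "i < k" and j: "j < m"
      using A' B' by simp_all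
    have "mat_adjoint (A * B) $$ (i, j) = (\<Sum>l = 0..<n. cnj (A $$ (j, l) * B $$ (l, i)))"
      using i j A B by (simp add: mat_adjoint_index[OF AB] scalar_prod_def)
    also have "\<dots> = (mat_adjoint B * mat_adjoint A) $$ (i, j)"
      using i j A' B'
      by (simp add: scalar_prod_def mat_adjoint_index[OF A] mat_adjoint_index[OF B] mult.commute)
    finally show "mat_adjoint (A * B) $$ (i, j) = (mat_adjoint B * mat_adjoint A) $$ (i, j)" .
  qed (use A' B' AB' in simp_all)
qed

lemma mat_adjoint_Gram:
  fixes A :: "complex mat"
  shows "mat_adjoint (mat_adjoint A * A) = mat_adjoint A * A"
proof -
  have A: "A \<in> carrier_mat (dim_row A) (dim_col A)"
    by simp
  show ?thesis
    using mat_adjoint_mult[OF mat_adjoint_carrier[OF A] A] by (simp add: mat_adjoint_mat_adjoint)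
qed

lemma mat_adjoint_scalar_prod:
  fixes A :: "complex mat"
  assumes A: "A \<in> carrier_mat m n" and w: "w \<in> carrier_vec m" and v: "v \<in> carrier_vec n"
  shows "(mat_adjoint A *\<^sub>v w) \<bullet>c v = w \<bullet>c (A *\<^sub>v v)"
proof -
  note A' = mat_adjoint_carrier[OF A]
  have "(mat_adjoint A *\<^sub>v w) \<bullet>c v =
      (\<Sum>i = 0..<n. \<Sum>j = 0..<m. cnj (A $$ (j, i)) * w $ j * cnj (v $ i))"
    using A' w v by (simp add: scalar_prod_def mat_adjoint_index[OF A] sum_distrib_right)
  also have "\<dots> = (\<Sum>j = 0..<m. \<Sum>i = 0..<n. cnj (A $$ (j, i)) * w $ j * cnj (v $ i))"
    by (rule sum.swap)
  also have "\<dots> = w \<bullet>c (A *\<^sub>v v)"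
    using A w v by (simp add: scalar_prod_def sum_distrib_left ac_simps)
  finally show ?thesis .
qed

section \<open>Eigenvalues of Gram matrices\<close>

text \<open>For an eigenvector v, adjointness gives z |v|^2 = |A v|^2, so z is the quotient of a
  nonnegative real by a positive one.\<close>

lemma proots_char_poly_Gram_nonneg:
  fixes A :: "complex mat"
  assumes z: "z \<in># proots (char_poly (mat_adjoint A * A))"
  shows "z \<in> \<real>" "0 \<le> Re z"
proof -
  define m n where "m = dim_row A" and "n = dim_col A"
  have A: "A \<in> carrier_mat m n"
    by (simp add: m_def n_def)
  note A' = mat_adjoint_carrier[OF A]
  have G: "mat_adjoint A * A \<in> carrier_mat n n"
    using A A' by simp
  \<comment> \<open>\<open>proots\<close> of the zero polynomial is empty, so the presence of z
    excludes it.\<close>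
  have "char_poly (mat_adjoint A * A) \<noteq> 0"
    using z by force
  then have "eigenvalue (mat_adjoint A * A) z"
    using z by (simp add: eigenvalue_root_char_poly[OF G])
  then obtain v where v: "v \<in> carrier_vec n" "v \<noteq> 0\<^sub>v n"
    and ev: "(mat_adjoint A * A) *\<^sub>v v = z \<cdot>\<^sub>v v"
    using G by (auto simp: eigenvalue_def eigenvector_def)
  have w: "A *\<^sub>v v \<in> carrier_vec m"
    using A v by simp
  have "z * (v \<bullet>c v) = (z \<cdot>\<^sub>v v) \<bullet>c v"
    using v by simp
  also have "\<dots> = (mat_adjoint A *\<^sub>v (A *\<^sub>v v)) \<bullet>c v"
    using A A' v by (simp flip: ev)
  also have "\<dots> = (A *\<^sub>v v) \<bullet>c (A *\<^sub>v v)"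
    by (rule mat_adjoint_scalar_prod[OF A w v(1)])
  finally have eq: "z * (v \<bullet>c v) = (A *\<^sub>v v) \<bullet>c (A *\<^sub>v v)" .
  have pos: "0 < v \<bullet>c v"
    using v by simp
  have nonneg: "0 \<le> (A *\<^sub>v v) \<bullet>c (A *\<^sub>v v)"
    by (rule conjugate_square_ge_0_vec)
  define s t where "s = Re (v \<bullet>c v)" and "t = Re ((A *\<^sub>v v) \<bullet>c (A *\<^sub>v v))"
  \<comment> \<open>Numbers that are comparable in the order on \<open>complex\<close> have equal
    imaginary parts, so \<open>pos\<close> and \<open>nonneg\<close> also say that both scalar
    products are real.\<close>
  have s: "v \<bullet>c v = of_real s" "0 < s"
    using pos by (auto simp: s_def less_complex_def complex_eq_iff)
  have t: "(A *\<^sub>v v) \<bullet>c (A *\<^sub>v v) = of_real t" "0 \<le> t"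
    using nonneg by (auto simp: t_def less_eq_complex_def complex_eq_iff)
  have z': "z = of_real (t / s)"
    using eq s t by (simp add: field_simps)
  show "z \<in> \<real>" "0 \<le> Re z"
    unfolding z' using s t by simp_all
qed

section \<open>Nonzero eigenvalues of \<open>A * B\<close> and \<open>B * A\<close>\<close>

lemma char_poly_zero_mat: "char_poly (0\<^sub>m n n) = [:0, 1:] ^ n"
proof -
  have "diag_mat (0\<^sub>m n n) = replicate n 0"
    by (simp add: diag_mat_def map_replicate_trivial list_eq_iff_nth_eq)
  then show ?thesis
    by (simp add: char_poly_upper_triangular[OF zero_carrier_mat])
qed

text \<open>
  Sylvester's identity: the block matrices with rows \<open>(A B, 0)\<close>, \<open>(B, 0)\<close> and \<open>(0, 0)\<close>, \<open>(B, B A)\<close>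
  are similar via the unipotent matrix with rows \<open>(1, A)\<close>, \<open>(0, 1)\<close>.
\<close>
lemma char_poly_mult_swap:
  fixes A B :: "complex mat"
  assumes A: "A \<in> carrier_mat m n" and B: "B \<in> carrier_mat n m"
  shows "char_poly (A * B) * [:0, 1:] ^ n = [:0, 1:] ^ m * char_poly (B * A)"
proof -
  define M where "M = four_block_mat (A * B) (0\<^sub>m m n) B (0\<^sub>m n n)"
  define N where "N = four_block_mat (0\<^sub>m m m) (0\<^sub>m m n) B (B * A)"
  define P where "P = four_block_mat (1\<^sub>m m) A (0\<^sub>m n m) (1\<^sub>m n)"
  define Q where "Q = four_block_mat (1\<^sub>m m) (- A) (0\<^sub>m n m) (1\<^sub>m n)"
  have AB: "A * B \<in> carrier_mat m m" and BA: "B * A \<in> carrier_mat n n" and A': "- A \<in> carrier_mat m n"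
    using A B by simp_all
  have PN: "P * N = four_block_mat (A * B) (A * (B * A)) B (B * A)"
    unfolding P_def N_def
    using A B AB BA
    by (subst mult_four_block_mat[of _ m m _ n _ n _ _ m _ n]) simp_all
  have neg_zero: "- 0\<^sub>m n n = (0\<^sub>m n n :: complex mat)"
    by (intro eq_matI) simp_all
  have PQ: "P * Q = 1\<^sub>m (m + n)" "Q * P = 1\<^sub>m (m + n)"
    unfolding P_def Q_def
    using A A'
    by (subst mult_four_block_mat[of _ m m _ n _ n _ _ m _ n];
        simp add: four_block_one_mat neg_zero comm_add_mat[of A m n "- A"])+
  have "M * P = four_block_mat (A * B) (A * (B * A)) B (B * A)"
    unfolding M_def P_def
    using A B AB BA
    by (subst mult_four_block_mat[of _ m m _ n _ n _ _ m _ n]) simp_all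
  then have "M * P = P * N"
    by (simp only: PN)
  have car: "M \<in> carrier_mat (m + n) (m + n)" "N \<in> carrier_mat (m + n) (m + n)"
    "P \<in> carrier_mat (m + n) (m + n)" "Q \<in> carrier_mat (m + n) (m + n)"
    using A B AB BA by (simp_all add: M_def N_def P_def Q_def)
  have "P * N * Q = M * (P * Q)"
    unfolding \<open>M * P = P * N\<close>[symmetric] using car by (intro assoc_mult_mat)
  then have "M = P * N * Q"
    unfolding PQ using right_mult_one_mat[OF car(1)] by simp
  then have "similar_mat M N"
    using car PQ by (intro similar_matI[of _ _ P Q "m + n"]) simp_all
  then have "char_poly M = char_poly N"
    by (rule char_poly_similar)
  \<comment> \<open>The product rule for block triangular matrices applied below asks that the
    characteristic polynomials of both diagonal blocks split, which holds over the complex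
    numbers.\<close>
  moreover have split: "\<exists>es. char_poly C = (\<Prod>a\<leftarrow>es. [:- a, 1:])"
    if "C \<in> carrier_mat k k" for C :: "complex mat" and k
    using char_poly_factorized[OF that] by blast
  have "char_poly M = char_poly (A * B) * char_poly (0\<^sub>m n n)"
    by (rule char_poly_0_block'[OF M_def split[OF AB] split[OF zero_carrier_mat] AB B zero_carrier_mat])
  moreover have "char_poly N = char_poly (0\<^sub>m m m) * char_poly (B * A)"
    by (rule char_poly_0_block'[OF N_def split[OF zero_carrier_mat] split[OF BA] zero_carrier_mat B BA])
  ultimately show ?thesis
    by (simp add: char_poly_zero_mat)
qed

text \<open>The extra factors in Sylvester's identity are powers of X, whose only root is 0, so they
  disappear once the root 0 is discarded.\<close>

lemma proots_char_poly_mult_swap: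
  fixes A B :: "complex mat"
  assumes A: "A \<in> carrier_mat m n" and B: "B \<in> carrier_mat n m"
  shows "filter_mset (\<lambda>z. z \<noteq> 0) (proots (char_poly (A * B))) =
    filter_mset (\<lambda>z. z \<noteq> 0) (proots (char_poly (B * A)))"
proof -
  have X: "proots ([:0, 1:] ^ k) = replicate_mset k (0 :: complex)" for k
    by (simp add: proots_power)
  have AB: "A * B \<in> carrier_mat m m" and BA: "B * A \<in> carrier_mat n n"
    using A B by simp_all
  have "char_poly (A * B) \<noteq> 0" "char_poly (B * A) \<noteq> 0"
    using degree_monic_char_poly[OF AB] degree_monic_char_poly[OF BA] by auto
  then have eq: "proots (char_poly (A * B)) + replicate_mset n 0 =
      replicate_mset m 0 + proots (char_poly (B * A))"
    using arg_cong[OF char_poly_mult_swap[OF A B], of proots] by (simp add: proots_mult X)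
  have "filter_mset (\<lambda>z. z \<noteq> 0) (replicate_mset k (0 :: complex)) = {#}" for k
    by (induction k) simp_all
  then show ?thesis
    using arg_cong[OF eq, of "filter_mset (\<lambda>z. z \<noteq> 0)"]
    by (simp only: filter_union_mset add_0 add_0_right)
qed

section \<open>Eigenvalues of the square of a matrix\<close>

lemma upper_triangular_mult_diag:
  fixes T :: "'a :: comm_ring_1 mat"
  assumes T: "T \<in> carrier_mat n n" "upper_triangular T"
  shows "upper_triangular (T * T)" "diag_mat (T * T) = map (\<lambda>a. a ^ 2) (diag_mat T)"
proof -
  have entry: "(T * T) $$ (i, j) = (\<Sum>k = 0..<n. T $$ (i, k) * T $$ (k, j))"
    if "i < n" "j < n" for i j
    using T that by (simp add: scalar_prod_def)
  have zero: "T $$ (i, j) = 0" if "j < i" "i < n" for i j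
    using upper_triangularD[OF T(2), of j i] T(1) that by simp
  show "upper_triangular (T * T)"
  proof (rule upper_triangularI)
    fix i j
    assume "j < i" "i < dim_row (T * T)"
    then have "j < i" "i < n"
      using T by simp_all
    \<comment> \<open>If \<open>k < i\<close>, the first factor lies below the diagonal; otherwise
      \<open>j < i \<le> k\<close> and the second one does.\<close>
    moreover from this have "T $$ (i, k) * T $$ (k, j) = 0" if "k < n" for k
      using zero[of k i] zero[of j k] that by (cases "k < i") simp_all
    ultimately show "(T * T) $$ (i, j) = 0"
      by (simp add: entry)
  qed
  have "(T * T) $$ (i, i) = T $$ (i, i) ^ 2" if "i < n" for i
  proof -
    \<comment> \<open>For \<open>k \<noteq> i\<close>, one of the positions \<open>(i, k)\<close>
      and \<open>(k, i)\<close> lies below the diagonal.\<close>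
    have "(T * T) $$ (i, i) = (\<Sum>k = 0..<n. if k = i then T $$ (i, i) ^ 2 else 0)"
      unfolding entry[OF that that]
      using zero that by (intro sum.cong) (auto simp: power2_eq_square neq_iff)
    then show ?thesis
      using that by simp
  qed
  then show "diag_mat (T * T) = map (\<lambda>a. a ^ 2) (diag_mat T)"
    using T by (simp add: diag_mat_def)
qed

lemma proots_linear_factors: "proots (\<Prod>a\<leftarrow>as. [:- a, 1:]) = mset (as :: 'a :: idom list)"
proof (induction as)
  case (Cons a as)
  have "(\<Prod>a\<leftarrow>as. [:- a, 1:]) \<noteq> 0"
    by (auto simp: prod_list_zero_iff)
  then have "proots ([:- a, 1:] * (\<Prod>a\<leftarrow>as. [:- a, 1:])) = {#a#} + proots (\<Prod>a\<leftarrow>as. [:- a, 1:])"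
    by (subst proots_mult) simp_all
  then show ?case
    by (simp add: Cons.IH del: mult_pCons_left)
qed simp

text \<open>Schur decomposition makes \<open>H\<close> similar to an upper triangular
  \<open>T\<close>, hence \<open>H * H\<close> similar to \<open>T * T\<close>. The diagonals list
  the eigenvalues with multiplicity, and squaring \<open>T\<close> squares its diagonal
  entrywise.\<close>

lemma proots_char_poly_square:
  fixes H :: "complex mat"
  assumes H: "H \<in> carrier_mat n n"
  shows "proots (char_poly (H * H)) = image_mset (\<lambda>z. z ^ 2) (proots (char_poly H))"
proof -
  obtain es where "char_poly H = (\<Prod>a\<leftarrow>es. [:- a, 1:])"
    using char_poly_factorized[OF H] by blast
  from schur_decomposition_exists[OF H this] obtain T
    where T: "T \<in> carrier_mat n n" "upper_triangular T" and sim: "similar_mat H T"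
    by blast
  from sim obtain P Q where wit: "similar_mat_wit H T P Q"
    by (auto simp: similar_mat_def)
  have "similar_mat (H ^\<^sub>m 2) (T ^\<^sub>m 2)"
    using similar_mat_wit_pow[OF wit, of 2] by (auto simp: similar_mat_def)
  then have "similar_mat (H * H) (T * T)"
    using H T by (simp add: numeral_2_eq_2)
  then have "char_poly (H * H) = char_poly (T * T)"
    by (rule char_poly_similar)
  moreover have "char_poly (T * T) = (\<Prod>a\<leftarrow>diag_mat (T * T). [:- a, 1:])"
    using T upper_triangular_mult_diag(1)[OF T] by (intro char_poly_upper_triangular) auto
  ultimately have "proots (char_poly (H * H)) = mset (diag_mat (T * T))"
    by (simp only: proots_linear_factors)
  also have "\<dots> = image_mset (\<lambda>z. z ^ 2) (mset (diag_mat T))"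
    by (simp add: upper_triangular_mult_diag(2)[OF T])
  also have "mset (diag_mat T) = proots (char_poly H)"
    by (simp only: char_poly_similar[OF sim] char_poly_upper_triangular[OF T] proots_linear_factors)
  finally show ?thesis .
qed

section \<open>Positive singular values\<close>

text \<open>Zeros are discarded because \<open>A\<close> and its two Gram matrices may have
  different numbers of zero singular values. The remaining values are positive, since singular
  values are nonnegative.\<close>

definition positive_singular_values :: "complex mat \<Rightarrow> real multiset" where
  "positive_singular_values A = filter_mset (\<lambda>x. x \<noteq> 0) (mset (singular_values A))"

text \<open>In a decreasing nonnegative list the nonzero entries come first, so truncation to at
  least their number removes only zeros.\<close>

lemma filter_nonzero_take:
  fixes xs :: "real list"
  assumes "sorted_wrt (\<ge>) xs" "\<forall>x\<in>set xs. 0 \<le> x" "length (filter (\<lambda>x. x \<noteq> 0) xs) \<le> k"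
  shows "filter (\<lambda>x. x \<noteq> 0) (take k xs) = filter (\<lambda>x. x \<noteq> 0) xs"
proof -
  define us vs where "us = take k xs" and "vs = drop k xs"
  have xs: "xs = us @ vs"
    by (simp add: us_def vs_def)
  \<comment> \<open>A nonzero y beyond position k would make the k kept entries, all at least y,
    nonzero as well: more than k nonzero entries in total.\<close>
  have "y = 0" if y: "y \<in> set vs" for y
  proof (rule ccontr)
    assume "y \<noteq> 0"
    then have "0 < y"
      using y assms(2) by (force simp: xs)
    have "\<forall>x\<in>set us. y \<le> x"
      using assms(1) y by (simp add: xs sorted_wrt_append)
    then have "filter (\<lambda>x. x \<noteq> 0) us = us"
      using \<open>0 < y\<close> by (intro filter_True) force
    moreover have "length us = k"
      using y by (cases "k < length xs") (simp_all add: us_def vs_def)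
    moreover have "0 < length (filter (\<lambda>x. x \<noteq> 0) vs)"
      using y \<open>y \<noteq> 0\<close> by (auto simp: filter_empty_conv)
    ultimately show False
      using assms(3) by (simp add: xs)
  qed
  then have "filter (\<lambda>x. x \<noteq> 0) vs = []"
    by simp
  then have "filter (\<lambda>x. x \<noteq> 0) us = filter (\<lambda>x. x \<noteq> 0) xs"
    by (simp add: xs)
  then show ?thesis
    by (simp add: us_def)
qed

abbreviation sqrt_Re :: "complex \<Rightarrow> real" where
  "sqrt_Re z \<equiv> sqrt (Re z)"

lemma singular_values_nonneg:
  assumes "x \<in> set (singular_values A)"
  shows "0 \<le> x"
  using in_set_takeD[OF assms[unfolded singular_values_def]] proots_char_poly_Gram_nonneg(2)
  by auto

text \<open>Since \<open>sqrt\<close> vanishes on the reals only at 0, the conditions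
  \<open>sqrt_Re z \<noteq> 0\<close> and \<open>z \<noteq> 0\<close> agree for real z.\<close>

lemma filter_image_sqrt_Re:
  assumes "\<And>z. z \<in># M \<Longrightarrow> z \<in> \<real>"
  shows "filter_mset (\<lambda>x. x \<noteq> 0) (image_mset sqrt_Re M) =
    image_mset sqrt_Re (filter_mset (\<lambda>z. z \<noteq> 0) M)"
proof -
  have "sqrt_Re z \<noteq> 0 \<longleftrightarrow> z \<noteq> 0" if "z \<in># M" for z
    using assms[OF that] by (auto elim!: Reals_cases)
  then show ?thesis
    by (simp add: filter_mset_image_mset cong: filter_mset_cong)
qed

text \<open>The truncation in \<open>singular_values\<close> drops no nonzero value: there are at
  most n nonzero eigenvalues because the Gram matrix has size n, and at most m because they are also
  those of \<open>A * mat_adjoint A\<close>, which has size m.\<close>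

lemma positive_singular_values_eq:
  "positive_singular_values A =
    image_mset sqrt_Re (filter_mset (\<lambda>z. z \<noteq> 0) (proots (char_poly (mat_adjoint A * A))))"
proof -
  define m n where "m = dim_row A" and "n = dim_col A"
  have A: "A \<in> carrier_mat m n"
    by (simp add: m_def n_def)
  note A' = mat_adjoint_carrier[OF A]
  define E where "E = proots (char_poly (mat_adjoint A * A))"
  define xs where "xs = rev (sorted_list_of_multiset (image_mset sqrt_Re E))"
  have real: "z \<in> \<real>" and nonneg: "0 \<le> Re z" if "z \<in># E" for z
    using proots_char_poly_Gram_nonneg[of z A] that by (simp_all add: E_def)
  have size: "size (proots (char_poly C)) = k" if "C \<in> carrier_mat k k" for C :: "complex mat" and k
    using degree_monic_char_poly[OF that] by (simp add: size_proots_complex)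
  have "mat_adjoint A * A \<in> carrier_mat n n" "A * mat_adjoint A \<in> carrier_mat m m"
    using A A' by simp_all
  note sizes = this[THEN size]
  have "size (filter_mset (\<lambda>z. z \<noteq> 0) E) \<le> n"
    using size_filter_mset_lesseq[of "\<lambda>z. z \<noteq> 0" E] sizes by (simp add: E_def)
  moreover have "size (filter_mset (\<lambda>z. z \<noteq> 0) E) \<le> m"
    using size_filter_mset_lesseq[of "\<lambda>z. z \<noteq> 0" "proots (char_poly (A * mat_adjoint A))"] sizes
    by (simp add: E_def proots_char_poly_mult_swap[OF A' A])
  moreover have xs: "mset (filter (\<lambda>x. x \<noteq> 0) xs) = image_mset sqrt_Re (filter_mset (\<lambda>z. z \<noteq> 0) E)"
    using real by (simp add: xs_def filter_image_sqrt_Re)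
  ultimately have "length (filter (\<lambda>x. x \<noteq> 0) xs) \<le> min m n"
    by (metis min.bounded_iff size_image_mset size_mset)
  moreover have "sorted_wrt (\<ge>) xs"
    by (simp add: xs_def sorted_wrt_rev)
  moreover have "\<forall>x\<in>set xs. 0 \<le> x"
    using nonneg by (auto simp: xs_def)
  ultimately have "filter (\<lambda>x. x \<noteq> 0) (take (min m n) xs) = filter (\<lambda>x. x \<noteq> 0) xs"
    by (intro filter_nonzero_take)
  moreover have "singular_values A = take (min m n) xs"
    by (simp add: singular_values_def xs_def E_def m_def n_def)
  ultimately show ?thesis
    using xs by (simp add: positive_singular_values_def E_def flip: mset_filter)
qed

text \<open>The Gram matrix of \<open>mat_adjoint A\<close> is \<open>A * mat_adjoint A\<close>, the
  product of the same factors in the other order.\<close>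

lemma positive_singular_values_adjoint:
  "positive_singular_values (mat_adjoint A) = positive_singular_values A"
proof -
  have A: "A \<in> carrier_mat (dim_row A) (dim_col A)"
    by simp
  show ?thesis
    by (simp add: positive_singular_values_eq mat_adjoint_mat_adjoint
        proots_char_poly_mult_swap[OF A mat_adjoint_carrier[OF A]])
qed

text \<open>The Gram matrix \<open>H\<close> of \<open>A\<close> is its own adjoint, so the Gram
  matrix of \<open>H\<close> is \<open>H * H\<close>, with eigenvalues \<open>z ^ 2\<close>. As z is
  real and nonnegative, \<open>sqrt_Re (z ^ 2)\<close> and \<open>sqrt_Re z ^ 2\<close> are both
  \<open>Re z\<close>.\<close>

lemma positive_singular_values_Gram:
  "positive_singular_values (mat_adjoint A * A) = image_mset (\<lambda>x. x ^ 2) (positive_singular_values A)"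
proof -
  have A: "A \<in> carrier_mat (dim_row A) (dim_col A)"
    by simp
  define H where "H = mat_adjoint A * A"
  have H: "H \<in> carrier_mat (dim_col A) (dim_col A)"
    unfolding H_def by (rule mult_carrier_mat[OF mat_adjoint_carrier[OF A] A])
  have adj: "mat_adjoint H = H"
    unfolding H_def by (rule mat_adjoint_Gram)
  have "sqrt_Re (z ^ 2) = sqrt_Re z ^ 2" if "z \<in># proots (char_poly H)" for z
  proof -
    have z: "z \<in> \<real>" "0 \<le> Re z"
      using proots_char_poly_Gram_nonneg that by (simp_all add: H_def)
    have "Re (z ^ 2) = Re z ^ 2"
      using z(1) by (auto elim!: Reals_cases simp flip: of_real_power)
    then show ?thesis
      using z(2) by simp
  qed
  then have "image_mset (\<lambda>z. sqrt_Re (z ^ 2)) (filter_mset (\<lambda>z. z \<noteq> 0) (proots (char_poly H))) =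
      image_mset (\<lambda>z. sqrt_Re z ^ 2) (filter_mset (\<lambda>z. z \<noteq> 0) (proots (char_poly H)))"
    by (intro image_mset_cong) simp
  then show ?thesis
    by (simp add: positive_singular_values_eq adj proots_char_poly_square[OF H]
        filter_mset_image_mset multiset.map_comp comp_def flip: H_def)
qed

section \<open>The stable rank as a sum over positive singular values\<close>

text \<open>Some entry of the decreasing list is positive, so its head is positive too and survives
  the filter.\<close>

lemma two_norm_eq_Max:
  assumes "positive_singular_values A \<noteq> {#}"
  shows "two_norm A = Max (set_mset (positive_singular_values A))"
proof -
  have set: "set_mset (positive_singular_values A) = {x \<in> set (singular_values A). x \<noteq> 0}"
    by (simp add: positive_singular_values_def)
  obtain x where x: "x \<in> set (singular_values A)" "x \<noteq> 0"
    using assms set by auto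
  then obtain y ys where y: "singular_values A = y # ys"
    by (cases "singular_values A") auto
  have le: "z \<le> y" if "z \<in> set (singular_values A)" for z
    using singular_values_decreasing[of A] that y by auto
  have "y \<noteq> 0"
    using le[OF x(1)] singular_values_nonneg[OF x(1)] x(2) by simp
  then have "Max (set_mset (positive_singular_values A)) = y"
    unfolding set by (intro Max_eqI) (auto simp: le y)
  then show ?thesis
    by (simp add: two_norm_def y)
qed

text \<open>Without positive singular values the sum is empty, so the value of \<open>Max {}\<close> is irrelevant.\<close>
lemma stable_rank_eq_sum:
  fixes p :: real
  assumes "A \<noteq> 0\<^sub>m (dim_row A) (dim_col A)" "1 \<le> p"
  shows "stable_rank (ereal p) A =
    (\<Sum>x\<in>#positive_singular_values A. (x / Max (set_mset (positive_singular_values A))) powr p)"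
proof -
  define S where "S = (\<Sum>\<sigma>\<leftarrow>singular_values A. \<sigma> powr p)"
  \<comment> \<open>Nonnegativity lets the exponents \<open>1 / p\<close> and \<open>p\<close>
    cancel: \<open>S powr 1 = S\<close> fails for negative \<open>S\<close>.\<close>
  have "0 \<le> S"
    unfolding S_def by (intro sum_list_nonneg) auto
  then have "schatten_norm p A powr p = S"
    using assms(2) by (simp add: schatten_norm_def powr_powr flip: S_def)
  \<comment> \<open>Zero entries drop out of the sum because \<open>0 powr p = 0\<close>.\<close>
  moreover have "sum_list (map (\<lambda>\<sigma>. \<sigma> powr p) xs) = (\<Sum>x\<in>#filter_mset (\<lambda>x. x \<noteq> 0) (mset xs). x powr p)" for xs
    by (induction xs) auto
  then have "S = (\<Sum>x\<in>#positive_singular_values A. x powr p)"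
    by (simp add: S_def positive_singular_values_def)
  ultimately have eq: "stable_rank (ereal p) A =
      (\<Sum>x\<in>#positive_singular_values A. x powr p) / two_norm A powr p"
    using assms(1) by (simp add: stable_rank_def)
  show ?thesis
  proof (cases "positive_singular_values A = {#}")
    case False
    define M where "M = Max (set_mset (positive_singular_values A))"
    have pos: "0 \<le> x" if "x \<in># positive_singular_values A" for x
      using that singular_values_nonneg by (auto simp: positive_singular_values_def)
    have "M \<in># positive_singular_values A"
      unfolding M_def using False by (intro Max_in) auto
    then have "0 \<le> M"
      by (rule pos)
    \<comment> \<open>An arbitrary multiset \<open>N\<close> keeps the maximum \<open>M\<close>
      fixed during the induction.\<close>
    have "(\<Sum>x\<in>#N. (x / M) powr p) = (\<Sum>x\<in>#N. x powr p) / M powr p"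
      if "\<And>x. x \<in># N \<Longrightarrow> 0 \<le> x" for N
      using that by (induction N) (simp_all add: powr_divide \<open>0 \<le> M\<close> add_divide_distrib)
    from this[OF pos] show ?thesis
      unfolding eq two_norm_eq_Max[OF False] M_def[symmetric] by simp
  qed (simp add: eq)
qed

section \<open>Comparison of stable ranks\<close>

text \<open>The abstract \<open>B\<close> stands for either of \<open>mat_adjoint A * A\<close> and
  \<open>A * mat_adjoint A\<close>. The assumption \<open>zero\<close> guarantees that
  \<open>A\<close> is nonzero whenever \<open>B\<close> is.\<close>

lemma stable_rank_Gram_le:
  assumes p: "1 \<le> p"
    and B: "positive_singular_values B = image_mset (\<lambda>x. x ^ 2) (positive_singular_values A)"
    and zero: "A = 0\<^sub>m (dim_row A) (dim_col A) \<Longrightarrow> B = 0\<^sub>m (dim_row B) (dim_col B)"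
  shows "stable_rank p B \<le> stable_rank p A"
proof (cases p)
  case (real r)
  with p have r: "1 \<le> r"
    by simp
  define N where "N = positive_singular_values A"
  define M where "M = Max (set_mset N)"
  have pos: "0 < x" if "x \<in># N" for x
    using that singular_values_nonneg[of x A]
    by (auto simp: N_def positive_singular_values_def)
  show ?thesis
  proof (cases "B = 0\<^sub>m (dim_row B) (dim_col B)")
    case True
    then have "stable_rank p B = 0"
      by (simp add: stable_rank_def)
    also have "0 \<le> stable_rank p A"
      by (simp add: stable_rank_def real)
    finally show ?thesis .
  next
    case False
    with zero have A: "A \<noteq> 0\<^sub>m (dim_row A) (dim_col A)"
      by blast
    have "stable_rank p B = (\<Sum>x\<in>#N. (x ^ 2 / Max ((\<lambda>x. x ^ 2) ` set_mset N)) powr r)"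
      by (simp add: real stable_rank_eq_sum[OF False r] B image_mset.compositionality comp_def
          flip: N_def)
    also have "\<dots> \<le> (\<Sum>x\<in>#N. (x / M) powr r)"
    proof (rule sum_mset_mono)
      fix x
      assume x: "x \<in># N"
      \<comment> \<open>The summand x shows that \<open>N\<close> is nonempty, so the maximum is
        attained.\<close>
      then have "M \<in># N"
        unfolding M_def by (intro Max_in) auto
      have le: "y \<le> M" if "y \<in># N" for y
        unfolding M_def using that by (intro Max_ge) auto
      \<comment> \<open>Squaring is monotone on nonnegative reals, hence commutes with the
        maximum.\<close>
      have "Max ((\<lambda>x. x ^ 2) ` set_mset N) = M ^ 2"
        using \<open>M \<in># N\<close> le less_imp_le[OF pos] by (intro Max_eqI) (auto intro: power_mono)
      moreover have "0 \<le> x / M" "x / M \<le> 1"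
        using pos[OF x] pos[OF \<open>M \<in># N\<close>] le[OF x] by simp_all
      then have "((x / M) ^ 2) powr r \<le> (x / M) powr r"
        using r power_decreasing[of 1 2 "x / M"] by (intro powr_mono2) simp_all
      ultimately show "(x ^ 2 / Max ((\<lambda>x. x ^ 2) ` set_mset N)) powr r \<le> (x / M) powr r"
        by (simp add: power_divide)
    qed
    also have "\<dots> = stable_rank p A"
      by (simp add: real stable_rank_eq_sum[OF A r] M_def N_def)
    finally show ?thesis .
  qed
next
  \<comment> \<open>Both stable ranks are 0 or 1, and \<open>zero\<close> excludes the pair with 1
    for \<open>B\<close> and 0 for \<open>A\<close>.\<close>
  case PInf
  with zero show ?thesis
    by (auto simp: stable_rank_def)
next
  case MInf
  with p show ?thesis
    by simp
qed

theorem theorem5p17: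
  fixes A :: "complex mat" and m n :: nat and p :: ereal
  assumes "1 \<le> p" and "A \<in> carrier_mat m n"
  shows "stable_rank p (mat_adjoint A * A) \<le> stable_rank p A
       \<and> stable_rank p (A * mat_adjoint A) \<le> stable_rank p A"
proof
  note A = assms(2)
  note A' = mat_adjoint_carrier[OF A]
  have zero: "mat_adjoint A * A = 0\<^sub>m n n" "A * mat_adjoint A = 0\<^sub>m m m"
    if "A = 0\<^sub>m (dim_row A) (dim_col A)"
  proof -
    have "A = 0\<^sub>m m n"
      using A that by simp
    then show "mat_adjoint A * A = 0\<^sub>m n n" "A * mat_adjoint A = 0\<^sub>m m m"
      using A' by (metis right_mult_zero_mat, metis left_mult_zero_mat)
  qed
  show "stable_rank p (mat_adjoint A * A) \<le> stable_rank p A"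
    using zero(1) A A'
    by (intro stable_rank_Gram_le[OF assms(1) positive_singular_values_Gram]) simp
  \<comment> \<open>\<open>A * mat_adjoint A\<close> is the Gram matrix of
    \<open>mat_adjoint A\<close>, which shares its positive singular values with
    \<open>A\<close>.\<close>
  have "positive_singular_values (A * mat_adjoint A) =
      image_mset (\<lambda>x. x ^ 2) (positive_singular_values A)"
    using positive_singular_values_Gram[of "mat_adjoint A"]
    by (simp add: mat_adjoint_mat_adjoint positive_singular_values_adjoint)
  then show "stable_rank p (A * mat_adjoint A) \<le> stable_rank p A"
    using zero(2) A A' by (intro stable_rank_Gram_le[OF assms(1)]) simp_all
qed

end
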